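(* Let $(F_n)_{n\ge 1}$ be the Fibonacci sequence ($F_1=F_2=1$, $F_{n+2}=F_{n+1}+F_n$), and let $\mathcal{A}:=\{\gcd(n,F_n) : n\ge 1\}$. There is an absolute constant $c>0$ such that $\#\big(\mathcal{A}\cap[1,x]\big)\ge c\, x/\log x$ for all real $x\ge 2$. *)

theory Defs
  imports Complex_Main "HOL-Number_Theory.Fib"
begin

definition gcdFibSet :: "nat set" where
  "gcdFibSet = {gcd n (fib n) | n. n \<ge> 1}"

end

theory Submission
  imports
    Defs
    "HOL-Number_Theory.Number_Theory"
    "HOL-Analysis.Analysis"
    "HOL-Real_Asymp.Real_Asymp"
begin

text \<open>
  A prime \<open>p > 5\<close> divides \<open>fib r\<close> for some \<open>r \<in> {p - 1, p + 1}\<close>, so \<open>gcd (p * r) (fib (p * r))\<close> has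
  the form \<open>p * h\<close> with \<open>h dvd r\<close>. It suffices that \<open>h\<close> is bounded by a constant \<open>C\<close> for a positive
  proportion of the primes: the map from \<open>p\<close> to \<open>p * h\<close> is then at most \<open>C\<close>-to-one.

  If a prime \<open>q > 5\<close> divides \<open>h\<close>, then \<open>q * z(q) dvd r\<close>, where \<open>z(q)\<close> is the rank of appearance of
  \<open>q\<close>. Hence \<open>h\<close> can be large only if \<open>p - 1\<close> or \<open>p + 1\<close> is divisible by \<open>q * z(q)\<close> for a large prime
  \<open>q\<close> or by a high power of a small prime. An elementary Chebyshev-type argument bounds the number of
  primes \<open>p\<close> in \<open>(y/64, y]\<close> with \<open>d dvd p - 1\<close> or \<open>d dvd p + 1\<close> by \<open>O(y / ln y * (ln d / d))\<close>,
  uniformly in \<open>d \<ge> 128\<close>, and the loss of the factor \<open>ln d\<close> against Brun--Titchmarsh is harmless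
  because the sum of \<open>ln (q * z(q)) / (q * z(q))\<close> over all primes \<open>q\<close> converges.
\<close>

section \<open>Fibonacci numbers modulo primes\<close>

text \<open>Binet's formula with both powers expanded binomially: even powers of
  \<open>sqrt 5\<close> cancel. Clearing the power of 2 leaves an identity of naturals that can be
  reduced modulo a prime.\<close>

lemma two_power_mult_fib:
  "2 ^ n * fib n = (\<Sum>k\<le>n. (n choose k) * (if odd k then 2 * 5 ^ (k div 2) else 0))"
proof -
  define s where "s = sqrt 5"
  have s: "s > 0" "s\<^sup>2 = 5" by (simp_all add: s_def)
  have odd_part: "s ^ k - (-s) ^ k = s * (if odd k then 2 * 5 ^ (k div 2) else 0)" for k
  proof (cases "odd k")
    case True
    then have "s ^ k = s * (s\<^sup>2) ^ (k div 2)"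
      by (metis odd_two_times_div_two_succ power_Suc power_mult Suc_eq_plus1)
    with True show ?thesis by (simp add: s)
  qed simp
  have "s * real (2 ^ n * fib n) = 2 ^ n * (((1 + s) / 2) ^ n - ((1 - s) / 2) ^ n)"
    using s by (simp add: fib_closed_form s_def field_simps)
  also have "\<dots> = (s + 1) ^ n - ((-s) + 1) ^ n"
    by (simp add: power_divide field_simps)
  also have "\<dots> = (\<Sum>k\<le>n. real (n choose k) * (s ^ k - (-s) ^ k))"
    unfolding binomial_ring by (simp add: sum_subtractf right_diff_distrib)
  also have "\<dots> = s * real (\<Sum>k\<le>n. (n choose k) * (if odd k then 2 * 5 ^ (k div 2) else 0))"
    unfolding odd_part by (simp add: sum_distrib_left mult_ac if_distrib cong: if_cong)
  finally show ?thesis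
    using s(1) by (simp only: mult_cancel_left of_nat_eq_iff) simp
qed

text \<open>For \<open>n = p\<close> every term of the binomial sum except the last vanishes modulo
  \<open>p\<close>, leaving a power of 5 with exponent \<open>(p - 1) / 2\<close>. Squaring makes
  Fermat's theorem applicable, so quadratic residues never enter.\<close>

lemma fib_prime_square_cong:
  fixes p :: nat
  assumes "prime p" "p \<noteq> 2" "p \<noteq> 5"
  shows "[(fib p)\<^sup>2 = 1] (mod p)"
proof -
  have odd: "odd p" using assms by (metis primes_dvd_imp_eq two_is_prime_nat)
  have p2: "\<not> p dvd 2" "\<not> p dvd 5"
    using assms primes_dvd_imp_eq[of p 2] primes_dvd_imp_eq[of p 5] by auto
  have "p > 0" using assms by (simp add: prime_gt_0_nat)
  have half: "2 * (p div 2) = p - 1" using odd by presburger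
  let ?t = "\<lambda>k. (p choose k) * (if odd k then 2 * 5 ^ (k div 2) else 0)"
  have "p dvd ?t k" if "k < p" for k
    using dvd_choose_prime[of k p] that assms(1) \<open>p > 0\<close> by (cases "k = 0") auto
  then have "[(\<Sum>k<p. ?t k) = 0] (mod p)" by (intro dvd_sum cong_0_iff[THEN iffD2]) auto
  then have "[(\<Sum>k<p. ?t k) + 2 * 5 ^ (p div 2) = 0 + 2 * 5 ^ (p div 2)] (mod p)"
    by (intro cong_add cong_refl)
  moreover have "2 ^ p * fib p = (\<Sum>k<p. ?t k) + 2 * 5 ^ (p div 2)"
    unfolding two_power_mult_fib using odd by (simp add: lessThan_Suc_atMost [symmetric])
  ultimately have *: "[2 ^ p * fib p = 2 * 5 ^ (p div 2)] (mod p)"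
    by simp
  have "[2 * (2 ^ (p - 1) * fib p) = 2 * 5 ^ (p div 2)] (mod p)"
    using * \<open>p > 0\<close> by (simp add: power_eq_if mult.assoc)
  then have "[2 ^ (p - 1) * fib p = 5 ^ (p div 2)] (mod p)"
    using p2(1) assms(1) by (metis cong_mult_lcancel_nat prime_imp_coprime coprime_commute)
  then have "[(2 ^ (p - 1) * fib p)\<^sup>2 = (5 ^ (p div 2))\<^sup>2] (mod p)"
    by (rule cong_pow)
  then have **: "[(2 ^ (p - 1)) ^ 2 * (fib p)\<^sup>2 = 5 ^ (p - 1)] (mod p)"
    by (simp add: power_mult_distrib power_mult[symmetric] mult.commute half)
  have "[(2 ^ (p - 1)) ^ 2 * (fib p)\<^sup>2 = 1 ^ 2 * (fib p)\<^sup>2] (mod p)"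
    using fermat_theorem[OF assms(1) p2(1)] by (intro cong_mult cong_pow cong_refl)
  with ** fermat_theorem[OF assms(1) p2(2)] show ?thesis
    by (metis cong_sym cong_trans mult_1 one_power2)
qed

text \<open>Cassini's identity at an odd index factors \<open>(fib p)^2 - 1\<close>, which is 0
  modulo \<open>p\<close>.\<close>

lemma prime_dvd_fib_neighbour:
  fixes p :: nat
  assumes "prime p" "p \<noteq> 2" "p \<noteq> 5"
  shows "p dvd fib (p - 1) \<or> p dvd fib (p + 1)"
proof -
  have odd: "odd p" using assms by (metis primes_dvd_imp_eq two_is_prime_nat)
  then obtain n where n: "p = Suc n" "even n" by (cases p) auto
  have "fib (p + 1) * fib (p - 1) = (fib p)\<^sup>2 - 1"
    using fib_Cassini_nat[of n] n by simp
  also have "p dvd \<dots>"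
    using fib_prime_square_cong[OF assms] fib_neq_0_nat[of p] n
    by (simp add: cong_altdef_nat Suc_le_eq)
  finally show ?thesis using assms(1) by (auto simp: prime_dvd_mult_iff)
qed

text \<open>Junk value if \<open>q\<close> divides no \<open>fib e\<close> with \<open>e > 0\<close>.\<close>
definition fib_rank :: "nat \<Rightarrow> nat" where
  "fib_rank q = (LEAST e. e > 0 \<and> q dvd fib e)"

lemma dvd_fib_gcd: "q dvd fib m \<Longrightarrow> q dvd fib n \<Longrightarrow> q dvd fib (gcd m n)"
  by (simp add: fib_gcd)

text \<open>By strong divisibility \<open>q\<close> also divides
  \<open>fib (gcd (fib_rank q) m)\<close>, and minimality forces this gcd to be the rank
  itself.\<close>

lemma fib_rank_dvd:
  assumes "m > 0" "q dvd fib m"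
  shows "fib_rank q > 0" "q dvd fib (fib_rank q)" "fib_rank q dvd m"
proof -
  have *: "fib_rank q > 0 \<and> q dvd fib (fib_rank q)"
    unfolding fib_rank_def by (rule LeastI[of _ m]) (use assms in auto)
  then show "fib_rank q > 0" "q dvd fib (fib_rank q)" by auto
  have "fib_rank q \<le> gcd (fib_rank q) m"
    using dvd_fib_gcd[of q "fib_rank q" m] * assms
    unfolding fib_rank_def by (intro Least_le) auto
  then show "fib_rank q dvd m"
    by (metis * dvd_imp_le gcd_dvd1 gcd_dvd2 le_antisym)
qed

lemma fib_rank_prime:
  assumes "prime q" "q > 5"
  obtains s where "s \<in> {q - 1, q + 1}" "fib_rank q dvd s" "fib_rank q > 0" "q dvd fib (fib_rank q)"
proof -
  obtain s where s: "s \<in> {q - 1, q + 1}" "q dvd fib s"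
    using prime_dvd_fib_neighbour[of q] assms by auto
  then have "s > 0" using assms by auto
  with s that fib_rank_dvd[of s q] show ?thesis by blast
qed

lemma fib_rank_prime_bounds:
  assumes "prime q" "q > 5"
  shows "fib_rank q > 0" "fib_rank q \<le> q + 1" "q dvd fib (fib_rank q)"
proof -
  obtain s where s: "s \<in> {q - 1, q + 1}" "fib_rank q dvd s" "fib_rank q > 0"
    "q dvd fib (fib_rank q)" using fib_rank_prime[OF assms] .
  then show "fib_rank q > 0" "q dvd fib (fib_rank q)" by auto
  have "fib_rank q \<le> s" using s assms by (intro dvd_imp_le) auto
  then show "fib_rank q \<le> q + 1" using s by auto
qed

text \<open>A prime factor \<open>q\<close> of the cofactor \<open>h\<close> is smaller than \<open>p\<close>, so its rank divides
  \<open>p * r\<close> without involving \<open>p\<close>; and the rank, a divisor of \<open>q - 1\<close> or \<open>q + 1\<close>, is coprime to \<open>q\<close>.\<close>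
lemma gcd_fib_cofactor:
  fixes p r :: nat
  assumes p: "prime p" "p > 5" and r: "r \<in> {p - 1, p + 1}" "p dvd fib r"
  obtains h where "gcd (p * r) (fib (p * r)) = p * h" "h > 0" "h dvd r"
    "\<And>q. prime q \<Longrightarrow> q > 5 \<Longrightarrow> q dvd h \<Longrightarrow> q * fib_rank q dvd r"
proof -
  have r0: "r > 0" using r p by auto
  have "fib r dvd fib (p * r)" by (metis dvd_triv_right fib_gcd gcd_nat.absorb_iff1)
  then have "p dvd gcd (p * r) (fib (p * r))" using r(2) by (auto intro: dvd_trans)
  then obtain h where h: "gcd (p * r) (fib (p * r)) = p * h" by (elim dvdE)
  have "p * h dvd p * r" "p * h dvd fib (p * r)" by (metis h gcd_dvd1, metis h gcd_dvd2)
  then have h_dvd: "h dvd r" "h dvd fib (p * r)" using p by (auto dest: dvd_mult_right)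
  have "q * fib_rank q dvd r" if q: "prime q" "q > 5" "q dvd h" for q
  proof -
    \<comment> \<open>Parity rules out \<open>q = p + 1\<close> and \<open>q = p - 1\<close>; this
      sharpens \<open>q \<le> r\<close> to \<open>q + 1 < p\<close>, and therefore
      \<open>fib_rank q < p\<close>.\<close>
    have odd: "odd p" "odd q"
      using prime_odd_nat p q by auto
    have qr: "q dvd r" "q dvd fib (p * r)" using h_dvd q by (auto intro: dvd_trans)
    have "q \<le> r" using qr r0 by (intro dvd_imp_le)
    moreover have "q \<noteq> p"
    proof
      assume "q = p"
      with qr(1) r(1) have "p dvd p - 1 \<or> p dvd p + 1" by auto
      then show False
        using p dvd_imp_le[of p "p - 1"] dvd_add_right_iff[of p p 1] by auto
    qed
    moreover have "q \<noteq> p + 1" using odd by auto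
    ultimately have "q < p" using r by auto
    then have "q + 1 < p" using odd by (metis Suc_eq_plus1 Suc_lessI even_Suc)
    obtain s where s: "s \<in> {q - 1, q + 1}" "fib_rank q dvd s" "fib_rank q > 0"
      "q dvd fib (fib_rank q)" using fib_rank_prime[OF q(1,2)] .
    have "fib_rank q < p" using fib_rank_prime_bounds[OF q(1,2)] \<open>q + 1 < p\<close> by simp
    then have "coprime (fib_rank q) p"
      using p(1) s(3) by (metis coprime_commute dvd_imp_le not_le prime_imp_coprime)
    moreover have "fib_rank q dvd p * r"
      using fib_rank_dvd[of "p * r" q] qr r0 p by auto
    ultimately have "fib_rank q dvd r" by (simp add: coprime_dvd_mult_right_iff)
    moreover have "coprime q s"
      using s(1) q coprime_diff_one_right_nat[of q] by auto
    then have "coprime q (fib_rank q)" by (rule coprime_divisors[OF dvd_refl s(2)])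
    ultimately show ?thesis using qr by (intro divides_mult)
  qed
  moreover have "h > 0" using h_dvd r0 by (auto intro: Nat.gr0I)
  ultimately show ?thesis using that[OF h _ h_dvd(1)] by auto
qed

section \<open>Chebyshev bounds\<close>

text \<open>Induction along the Leibniz harmonic triangle,
  \<open>1 / (Suc m * (n choose Suc m)) = 1 / (m * (n - 1 choose m)) - 1 / (m * (n choose m))\<close>.\<close>
lemma mult_binomial_dvd_common_multiple:
  fixes V N :: nat
  assumes V: "\<And>k. k \<in> {1..N} \<Longrightarrow> k dvd V" and "1 \<le> m" "m \<le> n" "n \<le> N"
  shows "m * (n choose m) dvd V"
proof -
  have "real V / (real m * real (n choose m)) \<in> \<int>"
    using assms(2-)
  proof (induction m arbitrary: n rule: dec_induct)
    case base
    then have "n dvd V" using V by auto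
    then show ?case using base by (auto elim!: dvdE)
  next
    case (step m)
    from step.prems step.hyps obtain k where k: "n = Suc k" by (cases n) auto
    define a where "a = real (n choose m)"
    have pos: "a > 0" "real m > 0" "real n - real m > 0" "real n > 0"
      using step by (auto simp: a_def)
    have e1: "(real m + 1) * real (n choose Suc m) = (real n - real m) * a"
    proof -
      have "Suc m * (n choose Suc m) = (n - m) * (n choose m)"
        by (simp only: binomial_absorption binomial_absorb_comp)
      then have "real (Suc m * (n choose Suc m)) = real ((n - m) * (n choose m))" by simp
      then show ?thesis using step by (simp add: a_def of_nat_diff algebra_simps)
    qed
    have e2: "real (k choose m) = (real n - real m) * a / real n"
    proof -
      have "(n - m) * (n choose m) = n * (k choose m)"
        using binomial_absorb_comp[of n m] by (simp only: k diff_Suc_1)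
      then have "real ((n - m) * (n choose m)) = real (n * (k choose m))" by simp
      then show ?thesis using step pos by (simp add: a_def of_nat_diff field_simps)
    qed
    have "real V / (real m * real (k choose m)) - real V / (real m * real (n choose m)) \<in> \<int>"
      using step k by (intro Ints_diff step.IH) auto
    also have "real V / (real m * real (k choose m)) - real V / (real m * real (n choose m))
        = real V / ((real n - real m) * a)"
      using pos unfolding e2 a_def[symmetric] by (simp add: field_simps)
    also have "\<dots> = real V / (real (Suc m) * real (n choose Suc m))"
      by (simp add: e1[symmetric] add.commute)
    finally show ?case .
  qed
  then obtain z where "real V / (real m * real (n choose m)) = of_int z"
    by (auto elim: Ints_cases)
  then have "real V = of_int z * real (m * (n choose m))"
    using assms by (simp add: field_simps)
  then have "int V = z * int (m * (n choose m))"
    by (metis of_int_eq_iff of_int_mult of_int_of_nat_eq)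
  then show ?thesis by (metis dvd_triv_right int_dvd_int_iff)
qed

definition primes_upto :: "nat \<Rightarrow> nat set" where
  "primes_upto n = {p. prime p \<and> p \<le> n}"

lemma finite_primes_upto [simp, intro]: "finite (primes_upto n)"
  by (rule finite_subset[of _ "{..n}"]) (auto simp: primes_upto_def)

text \<open>\<open>V\<close> is the least common multiple of \<open>1..N\<close>, a product over
  primes of factors at most \<open>N\<close>. It is a multiple of the central binomial coefficient,
  which is at least \<open>2 ^ n\<close>.\<close>

lemma two_power_le_power_card_primes:
  assumes "n \<ge> 1"
  shows "2 ^ n \<le> (2 * n) ^ card (primes_upto (2 * n))"
proof -
  define N where "N = 2 * n"
  have "\<exists>e. p ^ e \<le> N \<and> N < p ^ (e + 1)" if "prime p" for p
    using ex_power_ivl1[of p N] prime_ge_2_nat[OF that] assms by (auto simp: N_def)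
  then obtain e where e: "\<And>p. prime p \<Longrightarrow> p ^ e p \<le> N \<and> N < p ^ (e p + 1)" by metis
  define V where "V = (\<Prod>p\<in>primes_upto N. p ^ e p)"
  have Vpos: "V > 0" unfolding V_def
    by (intro prod_pos) (auto simp: primes_upto_def prime_gt_0_nat)
  have "k dvd V" if k: "k \<in> {1..N}" for k
  proof (rule multiplicity_le_imp_dvd)
    show "k \<noteq> 0" using k by auto
    fix p :: nat assume p: "prime p"
    have "p ^ multiplicity p k \<le> k" using k by (intro dvd_imp_le multiplicity_dvd) auto
    then have "p ^ multiplicity p k < p ^ (e p + 1)" using e[OF p] k by auto
    then have "multiplicity p k \<le> e p"
      using prime_gt_1_nat[OF p] by (simp add: power_strict_increasing_iff del: power_Suc)
    \<comment> \<open>\<open>V\<close> contains only primes up to \<open>N\<close>, so for larger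
      primes the multiplicity in \<open>k\<close> has to vanish.\<close>
    moreover have "e p = 0" if "p > N"
    proof (rule ccontr)
      assume "e p \<noteq> 0"
      then have "p ^ 1 \<le> p ^ e p" using prime_ge_1_nat[OF p] by (intro power_increasing) auto
      with e[OF p] that show False by simp
    qed
    ultimately show "multiplicity p k \<le> multiplicity p V"
      unfolding V_def using p
      by (subst multiplicity_prod_prime_powers) (auto simp: primes_upto_def)
  qed
  then have "n * (N choose n) dvd V"
    by (rule mult_binomial_dvd_common_multiple) (use assms in \<open>auto simp: N_def\<close>)
  then have "(N choose n) \<le> V"
    using Vpos by (meson dvd_imp_le dvd_mult_right)
  moreover have "V \<le> (\<Prod>p\<in>primes_upto N. N)"
    unfolding V_def using e by (intro prod_mono) (auto simp: primes_upto_def)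
  moreover have "2 ^ n \<le> (N choose n)"
  proof -
    have "real N / real n = 2" using assms by (simp add: N_def)
    then have "2 ^ n \<le> real (N choose n)"
      using binomial_ge_n_over_k_pow_k[of n N, where 'a = real] by (simp add: N_def)
    then have "real (2 ^ n) \<le> real (N choose n)" by simp
    then show ?thesis by (simp only: of_nat_le_iff)
  qed
  ultimately show ?thesis by (simp add: N_def)
qed

section \<open>Upper bounds for products of primes, and prime counts near \<open>y\<close>\<close>

lemma prod_primes_dvd:
  fixes m :: nat
  assumes "finite S" "\<And>p. p \<in> S \<Longrightarrow> prime p \<and> p dvd m"
  shows "\<Prod>S dvd m"
  using assms
proof (induction S rule: finite_induct)
  case (insert p S)
  then have "coprime p (\<Prod>S)"
    by (intro prod_coprime_right) (auto intro: primes_coprime)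
  with insert show ?case by (auto intro: divides_mult)
qed simp

text \<open>Erdos's induction: an even \<open>n > 2\<close> adds no prime, and for
  \<open>n = 2 * m + 1\<close> the primes in \<open>(m + 1, n]\<close> all divide
  \<open>n choose m\<close>, which is at most \<open>4 ^ m\<close> because it occurs twice in its
  row of Pascal's triangle.\<close>

lemma primorial_le: "\<Prod>(primes_upto n) \<le> 4 ^ n"
proof (induction n rule: less_induct)
  case (less n)
  show ?case
  proof (cases "n \<le> 2")
    case True
    have "primes_upto n \<subseteq> {2}" using True
      by (auto simp: primes_upto_def dest: prime_ge_2_nat)
    then have "primes_upto n = {} \<or> primes_upto n = {2} \<and> n = 2"
      using True by (auto simp: primes_upto_def)
    then show ?thesis by auto
  next
    case False
    show ?thesis
    proof (cases "even n")
      case True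
      then have "\<not> prime n" using False prime_odd_nat[of n] by auto
      moreover have "p \<le> n \<longleftrightarrow> p \<le> n - 1 \<or> p = n" for p
        using False by linarith
      ultimately have "primes_upto n = primes_upto (n - 1)"
        by (auto simp: primes_upto_def)
      moreover have "\<Prod>(primes_upto (n - 1)) \<le> 4 ^ (n - 1)" using False by (intro less) auto
      moreover have "4 ^ (n - 1) \<le> (4 ^ n :: nat)" by (intro power_increasing) auto
      ultimately show ?thesis by (metis le_trans)
    next
      case odd: False
      then obtain m where m: "n = 2 * m + 1" by (elim oddE)
      define S where "S = primes_upto n - primes_upto (m + 1)"
      have split: "primes_upto n = primes_upto (m + 1) \<union> S" using m
        by (auto simp: S_def primes_upto_def)
      have "\<Prod>S dvd (n choose m)"
      proof (rule prod_primes_dvd)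
        fix p assume "p \<in> S"
        then have p: "prime p" "p \<le> n" "p > m + 1" by (auto simp: S_def primes_upto_def)
        have "p dvd fact n" using p by (simp add: prime_dvd_fact_iff)
        also have "fact n = fact m * fact (n - m) * (n choose m)"
          using binomial_fact_lemma[of m n, symmetric] m by linarith
        finally have "p dvd fact m \<or> p dvd fact (n - m) \<or> p dvd (n choose m)"
          using p by (simp only: prime_dvd_mult_iff disj_assoc)
        moreover have "\<not> p dvd fact m" "\<not> p dvd fact (n - m)"
          using p m by (auto simp add: prime_dvd_fact_iff simp del: fact_Suc)
        ultimately show "prime p \<and> p dvd (n choose m)" using p by blast
      qed (auto simp: S_def)
      then have "\<Prod>S \<le> (n choose m)" using m by (intro dvd_imp_le) auto
      moreover have "2 * (n choose m) \<le> 2 ^ n"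
      proof -
        have "(n choose m) + (n choose (m + 1)) = (\<Sum>k\<in>{m, m + 1}. n choose k)" by simp
        also have "\<dots> \<le> (\<Sum>k\<le>n. n choose k)" using m by (intro sum_mono2) auto
        also have "\<dots> = 2 ^ n" by (rule choose_row_sum)
        also have "n choose (m + 1) = n choose m"
          using binomial_symmetric[of m n] by (simp add: m del: binomial_Suc_Suc)
        finally show ?thesis by simp
      qed
      then have "(n choose m) \<le> 4 ^ m" by (simp add: m power_mult)
      ultimately have "\<Prod>S \<le> 4 ^ m" by (rule le_trans)
      moreover have "\<Prod>(primes_upto (m + 1)) \<le> 4 ^ (m + 1)"
        using m False by (intro less) auto
      moreover have "\<Prod>(primes_upto n) = \<Prod>(primes_upto (m + 1)) * \<Prod>S"
        unfolding split by (intro prod.union_disjoint) (auto simp: S_def)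
      ultimately have "\<Prod>(primes_upto n) \<le> 4 ^ (m + 1) * 4 ^ m"
        by (metis mult_le_mono)
      also have "\<dots> = 4 ^ n" by (simp add: m power_add[symmetric] mult_2)
      finally show ?thesis .
    qed
  qed
qed


lemma card_primes_upto_ge:
  assumes "y \<ge> 2"
  shows "real (card (primes_upto y)) \<ge> real y / (8 * ln (real y))"
proof -
  define n where "n = y div 2"
  have n: "n \<ge> 1" "2 * n \<le> y" using assms by (auto simp: n_def)
  have "y \<le> 3 * n" using assms unfolding n_def by linarith
  then have n3: "real n \<ge> real y / 3" by linarith
  have L: "ln (real y) > 0" using assms by simp
  have "2 ^ n \<le> (2 * n) ^ card (primes_upto (2 * n))"
    by (rule two_power_le_power_card_primes) (use n in simp)
  also have "\<dots> \<le> y ^ card (primes_upto (2 * n))"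
    using n by (intro power_mono) auto
  also have "\<dots> \<le> y ^ card (primes_upto y)"
    using n by (intro power_increasing card_mono) (auto simp: primes_upto_def intro: order_trans)
  finally have "real (2 ^ n) \<le> real (y ^ card (primes_upto y))" by (simp only: of_nat_le_iff)
  then have "ln (2 ^ n) \<le> ln (real y ^ card (primes_upto y))"
    using assms by (subst ln_le_cancel_iff) auto
  then have *: "real n * ln 2 \<le> real (card (primes_upto y)) * ln (real y)"
    using assms by (simp add: ln_realpow)
  \<comment> \<open>Uses \<open>ln 2 \<ge> 1/2\<close>, obtained from
    \<open>ln t \<le> t - 1\<close> at \<open>t = 1/2\<close>.\<close>
  have "real y / 8 \<le> (real y / 3) * (1 / 2)" by simp
  also have "\<dots> \<le> real n * ln 2" using n3 ln_le_minus_one[of "1 / 2"] by (intro mult_mono) (auto simp: ln_div)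
  also note *
  finally show ?thesis using L by (simp add: field_simps)
qed

lemma sum_ln_primes_le:
  assumes "finite S" "\<And>p. p \<in> S \<Longrightarrow> prime p" "\<Prod>S \<le> m"
  shows "(\<Sum>p\<in>S. ln (real p)) \<le> ln (real m)"
proof -
  have "\<Prod>S > 0" using assms(2) by (auto intro!: prod_pos simp: prime_gt_0_nat)
  have "(\<Sum>p\<in>S. ln (real p)) = ln (real (\<Prod>S))"
    unfolding of_nat_prod using assms by (subst ln_prod) (auto simp: prime_gt_0_nat)
  also have "\<dots> \<le> ln (real m)"
    using assms(3) \<open>\<Prod>S > 0\<close> by (subst ln_le_cancel_iff) (simp_all del: of_nat_prod)
  finally show ?thesis .
qed

lemma sum_ln_primes_upto_le: "(\<Sum>p\<in>primes_upto n. ln (real p)) \<le> 2 * real n"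
proof -
  have "(\<Sum>p\<in>primes_upto n. ln (real p)) \<le> ln (real (4 ^ n))"
    using primorial_le by (intro sum_ln_primes_le) (auto simp: primes_upto_def)
  also have "\<dots> = real n * (2 * ln 2)"
    using ln_realpow[of 2 2] by (simp add: ln_realpow)
  also have "\<dots> \<le> real n * 2"
    using ln_le_minus_one[of 2] by (intro mult_left_mono) auto
  finally show ?thesis by simp
qed

text \<open>Each prime from \<open>sqrt y\<close> upwards contributes at least
  \<open>ln y / 2\<close> to the sum; this turns bounds on products of primes into bounds on their
  number.\<close>

lemma card_primes_large_le:
  assumes "y \<ge> 2" "\<And>p. p \<in> S \<Longrightarrow> prime p \<and> y \<le> p\<^sup>2" "finite S"
  shows "real (card S) * ln (real y) \<le> 2 * (\<Sum>p\<in>S. ln (real p))"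
proof -
  have "ln (real y) \<le> 2 * ln (real p)" if "p \<in> S" for p
  proof -
    have "real y \<le> real (p\<^sup>2)" using assms(2)[OF that] by (simp only: of_nat_le_iff)
    then have "ln (real y) \<le> ln (real p ^ 2)"
      using assms(1) assms(2)[OF that] by (subst ln_le_cancel_iff) (auto simp: prime_gt_0_nat)
    then show ?thesis using assms(2)[OF that] by (simp add: ln_realpow prime_gt_0_nat)
  qed
  then have "(\<Sum>p\<in>S. ln (real y)) \<le> (\<Sum>p\<in>S. 2 * ln (real p))" by (intro sum_mono)
  then show ?thesis by (simp add: sum_distrib_left)
qed

text \<open>The primes up to \<open>y div 64\<close> are removed from Chebyshev's lower bound, split
  at \<open>sqrt y\<close>: the larger ones cost \<open>y / (16 * ln y)\<close>, the smaller ones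
  \<open>y / (32 * ln y)\<close>, and 1/8 - 1/16 - 1/32 = 1/32.\<close>

lemma eventually_many_primes_near:
  "\<forall>\<^sub>F y in sequentially.
     real y / (32 * ln (real y)) \<le> real (card {p. prime p \<and> y div 64 < p \<and> p \<le> y})"
proof -
  have "\<forall>\<^sub>F y in sequentially. 32 * ln (real y) \<le> sqrt (real y)" by real_asymp
  moreover have "\<forall>\<^sub>F y::nat in sequentially. y \<ge> 2" by (rule eventually_ge_at_top)
  ultimately show ?thesis
  proof eventually_elim
    case (elim y)
    define L where "L = ln (real y)"
    have L: "L > 0" using elim by (simp add: L_def)
    define x where "x = y div 64"
    define S where "S = {p \<in> primes_upto x. y \<le> p\<^sup>2}"
    define T where "T = {p \<in> primes_upto x. p\<^sup>2 < y}"
    have "T \<subseteq> {1..nat \<lfloor>sqrt (real y)\<rfloor>}"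
    proof
      fix p assume "p \<in> T"
      then have "p \<ge> 1" "real (p\<^sup>2) \<le> real y"
        by (auto simp: T_def primes_upto_def Suc_le_eq prime_gt_0_nat simp del: of_nat_power)
      then show "p \<in> {1..nat \<lfloor>sqrt (real y)\<rfloor>}"
        by (auto simp: le_nat_floor real_le_rsqrt)
    qed
    then have "card T \<le> nat \<lfloor>sqrt (real y)\<rfloor>"
      using card_mono[of "{1..nat \<lfloor>sqrt (real y)\<rfloor>}" T] by simp
    then have T: "real (card T) \<le> sqrt (real y)"
      by (meson of_nat_0_le_iff of_nat_floor of_nat_le_iff order_trans real_sqrt_ge_zero)
    have "real (card S) * L \<le> 2 * (\<Sum>p\<in>S. ln (real p))"
      unfolding L_def using elim
      by (intro card_primes_large_le) (auto simp: S_def primes_upto_def)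
    also have "(\<Sum>p\<in>S. ln (real p)) \<le> (\<Sum>p\<in>primes_upto x. ln (real p))"
      by (intro sum_mono2) (auto simp: S_def primes_upto_def Suc_le_eq prime_gt_0_nat intro!: ln_ge_zero)
    also have "\<dots> \<le> 2 * real x" by (rule sum_ln_primes_upto_le)
    also have "real x \<le> real y / 64" unfolding x_def using of_nat_div_le_of_nat[of y 64, where 'a = real] by simp
    finally have S: "real (card S) \<le> real y / (16 * L)" using L by (simp add: field_simps)
    have sqrt_le: "sqrt (real y) \<le> real y / (32 * L)"
    proof -
      have "sqrt (real y) * (32 * L) \<le> sqrt (real y) * sqrt (real y)"
        using elim by (intro mult_left_mono) (auto simp: L_def)
      then show ?thesis using L by (simp add: field_simps)
    qed
    have "primes_upto y = {p. prime p \<and> x < p \<and> p \<le> y} \<union> (S \<union> T)"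
      by (auto simp: S_def T_def primes_upto_def x_def)
    then have "card (primes_upto y) \<le> card {p. prime p \<and> x < p \<and> p \<le> y} + (card S + card T)"
      by (metis (no_types, lifting) add_left_mono card_Un_le le_trans)
    then have "real (card (primes_upto y)) \<le>
        real (card {p. prime p \<and> x < p \<and> p \<le> y}) + (real (card S) + real (card T))"
      by linarith
    with card_primes_upto_ge[of y] elim S T sqrt_le
    have "real y / (8 * L) \<le> real (card {p. prime p \<and> x < p \<and> p \<le> y})
        + (real y / (16 * L) + real y / (32 * L))"
      unfolding L_def by linarith
    moreover have "real y / (8 * L) = 4 * (real y / (32 * L))"
      "real y / (16 * L) = 2 * (real y / (32 * L))" using L by (simp_all add: field_simps)
    ultimately show ?case unfolding x_def L_def by linarith
  qed
qed

section \<open>Primes in the residue classes 1 and -1\<close>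

text \<open>Legendre's recursion: the multiples of \<open>p\<close> up to \<open>n\<close>
  contribute \<open>m + multiplicity p (fact m)\<close> with
  \<open>m = n div p \<le> n / 2\<close>.\<close>

lemma multiplicity_fact_le:
  assumes "prime (p::nat)"
  shows "multiplicity p (fact n) \<le> n"
proof (induction n rule: less_induct)
  case (less n)
  show ?case
  proof (cases "n = 0")
    case False
    define m where "m = n div p"
    have p2: "p \<ge> 2" using assms by (rule prime_ge_2_nat)
    have mult: "{k \<in> {1..n}. p dvd k} = (\<lambda>j. p * j) ` {1..m}"
    proof (intro equalityI subsetI)
      fix k assume "k \<in> {k \<in> {1..n}. p dvd k}"
      then obtain j where j: "k = p * j" "1 \<le> k" "k \<le> n" by auto
      then have "j \<in> {1..m}" unfolding m_def
        using p2 by (auto simp: less_eq_div_iff_mult_less_eq mult.commute Suc_le_eq)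
      with j show "k \<in> (\<lambda>j. p * j) ` {1..m}" by auto
    next
      fix k assume "k \<in> (\<lambda>j. p * j) ` {1..m}"
      then show "k \<in> {k \<in> {1..n}. p dvd k}" unfolding m_def
        using p2 by (auto simp: less_eq_div_iff_mult_less_eq mult.commute Suc_le_eq)
    qed
    define c where "c = \<Prod>{k \<in> {1..n}. \<not> p dvd k}"
    have "\<not> p dvd c" unfolding c_def using assms by (subst prime_dvd_prod_iff) auto
    have "fact n = \<Prod>{1..n}" by (simp add: fact_prod)
    also have "{1..n} = {k \<in> {1..n}. p dvd k} \<union> {k \<in> {1..n}. \<not> p dvd k}" by auto
    also have "\<Prod>\<dots> = \<Prod>{k \<in> {1..n}. p dvd k} * c"
      unfolding c_def by (intro prod.union_disjoint) auto
    also have "\<Prod>{k \<in> {1..n}. p dvd k} = (\<Prod>j\<in>{1..m}. p * j)"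
      unfolding mult using p2 by (subst prod.reindex) (auto simp: inj_on_def)
    also have "\<dots> = p ^ m * fact m" by (simp add: prod.distrib fact_prod)
    finally have "multiplicity p (fact n) = multiplicity p (p ^ m * fact m * c)" by simp
    also have "\<dots> = m + multiplicity p (fact m) + multiplicity p c"
      using assms p2 \<open>\<not> p dvd c\<close>
      by (subst prime_elem_multiplicity_mult_distrib prime_elem_multiplicity_mult_distrib;
          auto intro!: Nat.gr0I)+
    also have "\<dots> = m + multiplicity p (fact m)"
      using \<open>\<not> p dvd c\<close> by (simp add: not_dvd_imp_multiplicity_0)
    also have "multiplicity p (fact m) \<le> m"
      using False p2 by (intro less) (auto simp: m_def)
    also have "m + m \<le> n"
      using p2 unfolding m_def
      by (metis mult_2 div_times_less_eq_dividend le_trans mult.commute mult_le_mono1)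
    finally show ?thesis by simp
  qed auto
qed

lemma prime_power_dvd_imp_dvd:
  fixes x y :: nat
  assumes "x \<noteq> 0" "\<And>p k. prime p \<Longrightarrow> p ^ k dvd x \<Longrightarrow> p ^ k dvd y"
  shows "x dvd y"
proof (cases "y = 0")
  case False
  show ?thesis
  proof (rule multiplicity_le_imp_dvd[OF assms(1)])
    fix p :: nat assume p: "prime p"
    then show "multiplicity p x \<le> multiplicity p y"
      using False assms(2)[OF p multiplicity_dvd] p
      by (intro multiplicity_geI) auto
  qed
qed simp

text \<open>For \<open>p\<close> not dividing \<open>d\<close>, an inverse of \<open>d\<close> modulo a power of \<open>p\<close> turns the product over the
  progression into a product of \<open>N\<close> consecutive integers.\<close>
lemma fact_dvd_prod_progression:
  fixes d :: nat and a :: int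
  shows "fact N dvd int d ^ N * (\<Prod>k=1..N. int d * int k + a)"
proof -
  define P where "P = (\<Prod>k=1..N. int d * int k + a)"
  have "fact N dvd nat \<bar>int d ^ N * P\<bar>"
  proof (rule prime_power_dvd_imp_dvd)
    fix p k :: nat assume p: "prime p" and k: "p ^ k dvd fact N"
    have "int p ^ k dvd int d ^ N * P"
    proof (cases "p dvd d")
      case True
      \<comment> \<open>Here the progression itself may contain no multiple of \<open>p\<close>; the
        factor \<open>d ^ N\<close> supplies the required power.\<close>
      have "k \<le> multiplicity p (fact N)"
        using k p by (intro multiplicity_geI) auto
      then have "k \<le> N" using multiplicity_fact_le[OF p, of N] by simp
      then have "int p ^ k dvd int d ^ N"
        using True by (meson dvd_power_le int_dvd_int_iff)
      then show ?thesis by simp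
    next
      case False
      then have "coprime d (p ^ k)"
        using p by (metis coprime_commute coprime_power_right_iff prime_imp_coprime)
      then have "coprime (int d) (int p ^ k)" by (metis coprime_int_iff of_nat_power)
      then obtain b where b: "[int d * b = 1] (mod int p ^ k)"
        using cong_solve_coprime_int by blast
      have "b ^ N * P = (\<Prod>k=1..N. b * (int d * int k + a))"
        by (simp add: P_def prod.distrib)
      also have "[\<dots> = (\<Prod>k=1..N. int k + a * b)] (mod int p ^ k)"
      proof (rule cong_prod)
        fix i
        have "[(int d * b) * int i + a * b = 1 * int i + a * b] (mod int p ^ k)"
          using b by (intro cong_add cong_mult cong_refl)
        then show "[b * (int d * int i + a) = int i + a * b] (mod int p ^ k)"
          by (simp add: algebra_simps)
      qed
      also have "(\<Prod>k=1..N. int k + a * b) = pochhammer (a * b + 1) N"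
        by (induction N) (simp_all add: pochhammer_Suc ac_simps)
      finally have c: "[b ^ N * P = pochhammer (a * b + 1) N] (mod int p ^ k)" .
      have "int (p ^ k) dvd int (fact N)" using k by (simp only: int_dvd_int_iff)
      then have "int p ^ k dvd pochhammer (a * b + 1) N"
        by (metis dvd_trans fact_dvd_pochhammer of_nat_fact of_nat_power)
      then have "int p ^ k dvd b ^ N * P" using c by (simp add: cong_dvd_iff)
      moreover have "coprime (int p ^ k) (b ^ N)"
        using b by (metis cong_imp_coprime cong_sym coprime_1_left coprime_commute
            coprime_mult_left_iff coprime_power_right_iff coprime_mult_right_iff)
      ultimately show ?thesis by (simp add: coprime_dvd_mult_right_iff)
    qed
    then show "p ^ k dvd nat \<bar>int d ^ N * P\<bar>"
      by (metis dvd_abs_iff nat_dvd_iff nat_int int_dvd_int_iff abs_ge_zero nat_0_le of_nat_power)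
  qed simp
  then show ?thesis unfolding P_def
    by (metis abs_ge_zero dvd_abs_iff int_dvd_int_iff nat_0_le of_nat_fact)
qed

text \<open>The integer \<open>Q = d ^ N * P / fact N\<close> plays the part of the binomial
  coefficient in Chebyshev's argument: a prime \<open>p > N\<close> in the progression divides
  \<open>P\<close> but not \<open>fact N\<close>, so it divides \<open>Q\<close>.\<close>

lemma prod_primes_progression_le:
  fixes d N :: nat and a :: int
  assumes d: "d \<ge> 2" and a: "\<bar>a\<bar> = 1" and "finite S"
    and S: "\<And>p. p \<in> S \<Longrightarrow> prime p \<and> p > N \<and> (\<exists>k\<in>{1..N}. int p = int d * int k + a)"
  shows "\<Prod>S \<le> d ^ (3 * N)"
proof -
  define P where "P = (\<Prod>k=1..N. int d * int k + a)"
  obtain Q where Q: "int d ^ N * P = fact N * Q"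
    using fact_dvd_prod_progression[of N d a] by (auto simp: P_def elim: dvdE)
  have dk: "int d * int k \<ge> 2 * int k" for k using d by (intro mult_right_mono) auto
  have pos: "0 < int d * int k + a" if "k \<in> {1..N}" for k
  proof -
    have "int k \<ge> 1" using that by auto
    with dk[of k] a show ?thesis by linarith
  qed
  have "P > 0" unfolding P_def using pos by (intro prod_pos) auto
  then have "0 < fact N * Q" unfolding Q[symmetric] using d by simp
  then have Qpos: "Q > 0" by (simp add: zero_less_mult_iff)
  \<comment> \<open>Each factor is at most \<open>2 * d * k\<close>, hence at most
    \<open>d ^ 2 * k\<close>; the product of the \<open>k\<close> then cancels
    \<open>fact N\<close>.\<close>
  have "P \<le> (\<Prod>k=1..N. int d ^ 2 * int k)"
    unfolding P_def
  proof (intro prod_mono conjI)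
    fix k assume k: "k \<in> {1..N}"
    show "0 \<le> int d * int k + a" using pos[OF k] by simp
    have "int d * int k + a \<le> 2 * (int d * int k)" using dk[of k] k a by (smt (verit) atLeastAtMost_iff of_nat_1 of_nat_le_iff)
    also have "\<dots> \<le> int d * (int d * int k)" using d by (intro mult_right_mono) auto
    finally show "int d * int k + a \<le> int d ^ 2 * int k" by (simp add: power2_eq_square)
  qed
  also have "\<dots> = int d ^ (2 * N) * fact N"
    by (simp add: prod.distrib power_mult fact_prod of_nat_prod)
  finally have "int d ^ N * P \<le> int d ^ N * (int d ^ (2 * N) * fact N)"
    by (intro mult_left_mono) auto
  then have "fact N * Q \<le> fact N * int d ^ (3 * N)"
    unfolding Q by (simp add: power_add[symmetric] mult_ac)
  then have "Q \<le> int d ^ (3 * N)" by (simp add: mult_le_cancel_left)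
  then have Qle: "nat Q \<le> d ^ (3 * N)" using Qpos by (simp add: nat_le_iff)
  have "\<Prod>S dvd nat Q"
  proof (rule prod_primes_dvd[OF \<open>finite S\<close>], intro conjI)
    fix p assume "p \<in> S"
    with S obtain k where k: "prime p" "p > N" "k \<in> {1..N}" "int p = int d * int k + a" by metis
    then show "prime p" by simp
    have pint: "prime (int p)" using k(1) by simp
    have "\<not> int p dvd int d"
    proof
      assume "int p dvd int d"
      then have "int p dvd int p - int d * int k" by (intro dvd_diff) auto
      then have "int p dvd a" using k by simp
      then have "int p dvd 1" using a by (metis dvd_abs_iff)
      then show False using pint not_prime_unit by blast
    qed
    then have "\<not> int p dvd int d ^ N" using pint prime_dvd_power by blast
    moreover have "int p dvd P" unfolding P_def using k by (intro dvd_prodI[THEN dvd_trans[rotated]]) auto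
    moreover have "\<not> int p dvd fact N"
      using k by (metis int_dvd_int_iff of_nat_fact not_le prime_dvd_fact_iff)
    moreover have "int p dvd fact N * Q" using \<open>int p dvd P\<close> unfolding Q[symmetric] by simp
    ultimately have "int p dvd Q" using pint by (simp add: prime_dvd_mult_iff)
    then show "p dvd nat Q" using Qpos by (simp add: nat_dvd_iff int_dvd_int_iff flip: dvd_nat_abs_iff)
  qed
  then show ?thesis using Qpos Qle by (meson dvd_imp_le le_trans zero_less_nat_eq)
qed

text \<open>The preceding product bound is applied to the residues 1 and -1. The condition
  \<open>d \<ge> 128\<close> gives \<open>N \<le> y div 64\<close>, so every counted prime exceeds
  \<open>N\<close>. Each residue costs \<open>6 * N * ln d\<close>, and
  \<open>N \<le> 2 * y / d\<close> yields the constant 24.\<close>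

lemma card_primes_neighbour_multiple_le:
  fixes d y :: nat
  assumes d: "d \<ge> 128" and y: "y \<ge> 4096"
  shows "real (card {p. prime p \<and> y div 64 < p \<and> p \<le> y \<and> (d dvd p - 1 \<or> d dvd p + 1)})
    \<le> 24 * real y / ln (real y) * (ln (real d) / real d)"
proof -
  \<comment> \<open>The numerator is \<open>y + 1\<close> because \<open>p + 1 = d * k\<close> is
    allowed to reach it.\<close>
  define N where "N = (y + 1) div d"
  define S where "S = (\<lambda>a::int. {p. prime p \<and> y div 64 < p \<and> p \<le> y \<and> int d dvd int p - a})"
  have fin: "finite (S a)" for a by (rule finite_subset[of _ "{..y}"]) (auto simp: S_def)
  have L: "ln (real y) > 0" using y by simp
  have N_le: "real N \<le> 2 * real y / real d"
  proof -
    have "real N \<le> real (y + 1) / real d" unfolding N_def by (rule of_nat_div_le_of_nat)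
    also have "\<dots> \<le> 2 * real y / real d" using y by (intro divide_right_mono) auto
    finally show ?thesis .
  qed
  have N_le': "N \<le> y div 64"
  proof -
    have "N \<le> (y + 1) div 128" unfolding N_def using d by (intro div_le_mono2) auto
    then show ?thesis by linarith
  qed
  have card_le: "real (card (S a)) * ln (real y) \<le> 6 * real N * ln (real d)" if a: "\<bar>a\<bar> = 1" for a
  proof -
    have "\<Prod>(S a) \<le> d ^ (3 * N)"
    proof (rule prod_primes_progression_le[OF _ a fin])
      fix p assume "p \<in> S a"
      then have p: "prime p" "y div 64 < p" "p \<le> y" "int d dvd int p - a" by (auto simp: S_def)
      then obtain j where j: "int p - a = int d * j" by (elim dvdE)
      have "int p \<ge> 2" using prime_ge_2_nat[OF p(1)] by simp
      then have "int d * j > 0" using j a by linarith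
      then have "j > 0" using d by (simp add: zero_less_mult_iff)
      then obtain k where k: "j = int k" "k \<ge> 1"
        by (metis int_nat_eq less_le nat_0_le of_nat_0_less_iff One_nat_def Suc_leI)
      have "int (d * k) \<le> int (y + 1)" using j k p a by auto
      then have "d * k \<le> y + 1" by (simp only: of_nat_le_iff)
      then have "k \<le> N" using d by (simp add: N_def less_eq_div_iff_mult_less_eq mult.commute)
      then show "prime p \<and> p > N \<and> (\<exists>k\<in>{1..N}. int p = int d * int k + a)"
        using p N_le' j k by (auto intro!: bexI[of _ k])
    qed (use d in auto)
    then have "(\<Sum>p\<in>S a. ln (real p)) \<le> ln (real (d ^ (3 * N)))"
      using fin by (intro sum_ln_primes_le) (auto simp: S_def)
    then have "(\<Sum>p\<in>S a. ln (real p)) \<le> 3 * real N * ln (real d)"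
      using d by (simp add: ln_realpow)
    moreover have "real (card (S a)) * ln (real y) \<le> 2 * (\<Sum>p\<in>S a. ln (real p))"
    proof (rule card_primes_large_le)
      fix p assume "p \<in> S a"
      then have p: "prime p" "y div 64 < p" by (auto simp: S_def)
      \<comment> \<open>Since \<open>4096 = 64 * 64\<close>, these two bounds give
        \<open>y \<le> p^2\<close>.\<close>
      then have "y \<le> 64 * p" "64 \<le> p" using y by auto
      then show "prime p \<and> y \<le> p\<^sup>2" using p
        by (metis le_trans mult_le_mono1 power2_eq_square)
    qed (use y fin in auto)
    ultimately show ?thesis by linarith
  qed
  have "{p. prime p \<and> y div 64 < p \<and> p \<le> y \<and> (d dvd p - 1 \<or> d dvd p + 1)} \<subseteq> S 1 \<union> S (-1)"
  proof
    fix p assume "p \<in> {p. prime p \<and> y div 64 < p \<and> p \<le> y \<and> (d dvd p - 1 \<or> d dvd p + 1)}"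
    then have p: "prime p" "y div 64 < p" "p \<le> y" "d dvd p - 1 \<or> d dvd p + 1" by auto
    have "int (p - 1) = int p - 1" using prime_gt_0_nat[OF p(1)] by (simp add: of_nat_diff)
    moreover have "int (p + 1) = int p - (-1)" by simp
    ultimately show "p \<in> S 1 \<union> S (-1)" using p unfolding S_def
      by (metis (mono_tags, lifting) UnI1 UnI2 int_dvd_int_iff mem_Collect_eq)
  qed
  then have "card {p. prime p \<and> y div 64 < p \<and> p \<le> y \<and> (d dvd p - 1 \<or> d dvd p + 1)}
      \<le> card (S 1) + card (S (-1))"
    by (meson card_Un_le card_mono fin finite_UnI le_trans)
  then have "real (card {p. prime p \<and> y div 64 < p \<and> p \<le> y \<and> (d dvd p - 1 \<or> d dvd p + 1)})
      * ln (real y) \<le> (real (card (S 1)) + real (card (S (-1)))) * ln (real y)"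
    using L by (intro mult_right_mono) auto
  also have "\<dots> \<le> 12 * real N * ln (real d)"
    using card_le[of 1] card_le[of "-1"] by (simp add: distrib_right)
  also have "\<dots> \<le> 12 * (2 * real y / real d) * ln (real d)"
    using N_le d by (intro mult_right_mono mult_left_mono) auto
  finally show ?thesis using L d by (simp add: field_simps)
qed

section \<open>Ranks of appearance\<close>

lemma fib_le_two_power: "fib n \<le> 2 ^ n"
  by (induction n rule: fib.induct) auto

text \<open>The product of distinct primes dividing \<open>fib e\<close> is at most
  \<open>fib e\<close>, hence at most \<open>2 ^ e\<close>.\<close>

lemma sum_ln_primes_of_fib_rank_le:
  assumes "finite S" "\<And>q. q \<in> S \<Longrightarrow> prime q \<and> q dvd fib e" "e > 0"
  shows "(\<Sum>q\<in>S. ln (real q)) \<le> real e"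
proof -
  have "\<Prod>S dvd fib e" by (rule prod_primes_dvd) (use assms in auto)
  then have "\<Prod>S \<le> fib e" using assms fib_neq_0_nat by (intro dvd_imp_le) auto
  also have "\<dots> \<le> 2 ^ e" by (rule fib_le_two_power)
  finally have "(\<Sum>q\<in>S. ln (real q)) \<le> ln (real (2 ^ e))"
    using assms by (intro sum_ln_primes_le) auto
  also have "\<dots> = real e * ln 2" by (simp add: ln_realpow)
  also have "\<dots> \<le> real e * 1" using ln_le_minus_one[of 2] by (intro mult_left_mono) auto
  finally show ?thesis by simp
qed

text \<open>Only \<open>fib e\<close> is available to bound the primes of rank \<open>e\<close>. This is enough for those with
  \<open>fib_rank q < sqrt q\<close>; the other primes contribute a convergent sum anyway.\<close>
lemma summable_ln_fib_rank:
  "summable (\<lambda>q. if prime q \<and> q > 5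
     then ln (real (q * fib_rank q)) / real (q * fib_rank q) else 0)"
  (is "summable ?f")
proof -
  \<comment> \<open>\<open>u\<close> majorises the primes of rank at least \<open>sqrt q\<close>.
    For the others, \<open>v e\<close> bounds the total of \<open>ln q / e ^ 3\<close> over the
    primes of rank \<open>e\<close>, as the sum of \<open>ln q\<close> is at most
    \<open>e\<close>.\<close>
  define u where "u = (\<lambda>n. ln (real n) / (real n * sqrt (real n)))"
  define v where "v = (\<lambda>n. inverse (real n ^ 2))"
  have "summable (\<lambda>n. norm (real n powr (-5/4)))"
    by (simp add: summable_real_powr_iff)
  \<comment> \<open>Any exponent strictly between -3/2 and -1 absorbs the logarithm and stays
    summable.\<close>
  moreover have "u \<in> O(\<lambda>n. real n powr (-5/4))" unfolding u_def by real_asymp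
  ultimately have u: "summable u" by (rule summable_comparison_test_bigo)
  have v: "summable v" unfolding v_def by (rule inverse_power_summable) simp
  have u0: "u n \<ge> 0" for n by (cases "n = 0") (auto simp: u_def)
  have v0: "v n \<ge> 0" for n by (simp add: v_def)
  have ptw: "?f q \<le> 3 * (u q + ln (real q) / real (fib_rank q) ^ 3)" if q: "prime q" "q > 5" for q
  proof -
    define z where "z = fib_rank q"
    have z: "z > 0" "z \<le> q + 1" using fib_rank_prime_bounds[OF q] by (auto simp: z_def)
    have "z \<le> q * q" using z(2) q mult_le_mono1[of 2 q q] by linarith
    then have "q * z \<le> q ^ 3" by (simp add: power3_eq_cube)
    then have "real (q * z) \<le> real (q ^ 3)" by (simp only: of_nat_le_iff)
    then have "ln (real (q * z)) \<le> ln (real (q ^ 3))"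
      using z q by (subst ln_le_cancel_iff) auto
    also have "\<dots> = 3 * ln (real q)" using q by (simp add: ln_realpow)
    finally have 1: "ln (real (q * z)) \<le> 3 * ln (real q)" .
    have 2: "1 / real (q * z) \<le> 1 / (real q * sqrt (real q)) + 1 / real z ^ 3"
    proof (cases "q \<le> z\<^sup>2")
      case True
      then have "real q \<le> real (z\<^sup>2)" by (simp only: of_nat_le_iff)
      then have "sqrt (real q) \<le> real z" by (intro real_le_lsqrt) auto
      then have "real q * sqrt (real q) \<le> real (q * z)" by (simp add: mult_left_mono)
      then have "1 / real (q * z) \<le> 1 / (real q * sqrt (real q))"
        using q by (intro divide_left_mono) (auto intro!: mult_pos_pos simp: z)
      then show ?thesis by (simp add: add_increasing2)
    next
      case False
      then have "z ^ 3 \<le> q * z" by (simp add: power3_eq_cube power2_eq_square)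
      then have "real (z ^ 3) \<le> real (q * z)" by (simp only: of_nat_le_iff)
      then have "1 / real (q * z) \<le> 1 / real z ^ 3"
        using q z by (intro divide_left_mono) auto
      then show ?thesis by (simp add: add_increasing)
    qed
    have "?f q = ln (real (q * z)) * (1 / real (q * z))" using q by (simp add: z_def)
    also have "\<dots> \<le> (3 * ln (real q)) * (1 / (real q * sqrt (real q)) + 1 / real z ^ 3)"
      using 1 2 q by (intro mult_mono) auto
    also have "\<dots> = 3 * (u q + ln (real q) / real z ^ 3)" by (simp add: u_def algebra_simps)
    finally show ?thesis by (simp add: z_def)
  qed
  have bounded: "(\<Sum>q<M. ?f q) \<le> 3 * (suminf u + suminf v)" for M
  proof -
    define S where "S = {q \<in> {..<M}. prime q \<and> q > 5}"
    have fin: "finite S" by (simp add: S_def)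
    define W where "W = (\<Sum>q\<in>S. ln (real q) / real (fib_rank q) ^ 3)"
    have "(\<Sum>q<M. ?f q) = (\<Sum>q\<in>S. ?f q)"
      unfolding S_def by (intro sum.mono_neutral_right) auto
    also have "\<dots> \<le> (\<Sum>q\<in>S. 3 * (u q + ln (real q) / real (fib_rank q) ^ 3))"
      by (intro sum_mono ptw) (auto simp: S_def)
    also have "\<dots> = 3 * (sum u S + W)"
      by (simp add: W_def sum_distrib_left sum.distrib distrib_left)
    finally have le: "(\<Sum>q<M. ?f q) \<le> 3 * (sum u S + W)" .
    have "sum u S \<le> suminf u" using u fin u0 by (intro sum_le_suminf) auto
    moreover have "W \<le> suminf v"
    proof -
      \<comment> \<open>Grouping by rank allows the bound for primes dividing a single
        \<open>fib e\<close> to be used.\<close>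
      have "W = (\<Sum>e\<in>{1..M + 1}. \<Sum>q\<in>{q \<in> S. fib_rank q = e}. ln (real q) / real (fib_rank q) ^ 3)"
        unfolding W_def
      proof (rule sum.group[symmetric])
        show "fib_rank ` S \<subseteq> {1..M + 1}"
        proof (rule image_subsetI)
          fix q assume "q \<in> S"
          then show "fib_rank q \<in> {1..M + 1}"
            using fib_rank_prime_bounds(1,2)[of q] by (auto simp: S_def)
        qed
      qed (use fin in auto)
      also have "\<dots> \<le> (\<Sum>e\<in>{1..M + 1}. v e)"
      proof (rule sum_mono)
        fix e assume e: "e \<in> {1..M + 1}"
        have "(\<Sum>q\<in>{q \<in> S. fib_rank q = e}. ln (real q) / real (fib_rank q) ^ 3)
            = (\<Sum>q\<in>{q \<in> S. fib_rank q = e}. ln (real q)) / real e ^ 3"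
          by (simp add: sum_divide_distrib)
        also have "\<dots> \<le> real e / real e ^ 3"
          using fin e
          by (intro divide_right_mono sum_ln_primes_of_fib_rank_le)
            (auto simp: S_def fib_rank_prime_bounds(3))
        also have "\<dots> = v e" using e by (simp add: v_def field_simps power3_eq_cube power2_eq_square)
        finally show "(\<Sum>q\<in>{q \<in> S. fib_rank q = e}. ln (real q) / real (fib_rank q) ^ 3) \<le> v e" .
      qed
      also have "\<dots> \<le> suminf v" using v v0 by (intro sum_le_suminf) auto
      finally show ?thesis .
    qed
    ultimately have "3 * (sum u S + W) \<le> 3 * (suminf u + suminf v)" by simp
    with le show ?thesis by (rule order_trans)
  qed
  have "?f n \<ge> 0" for n
  proof (cases "prime n \<and> n > 5")
    case True
    then have "n * fib_rank n > 0" using fib_rank_prime_bounds(1)[of n] by simp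
    then have "real (n * fib_rank n) \<ge> 1" by linarith
    then show ?thesis by (auto intro!: divide_nonneg_nonneg ln_ge_zero simp del: of_nat_mult)
  qed auto
  then show ?thesis using bounded by (rule summableI_nonneg_bounded)
qed

section \<open>Elements with a large prime factor\<close>

lemma smooth_le_prod_prime_powers:
  fixes h Q k :: nat
  assumes "h > 0" "\<And>q. prime q \<Longrightarrow> q dvd h \<Longrightarrow> q \<le> Q \<and> \<not> q ^ k dvd h"
  shows "h \<le> (\<Prod>q\<in>primes_upto Q. q ^ k)"
proof (rule dvd_imp_le)
  show "h dvd (\<Prod>q\<in>primes_upto Q. q ^ k)"
  proof (rule prime_power_dvd_imp_dvd)
    fix q j :: nat assume q: "prime q" "q ^ j dvd h"
    show "q ^ j dvd (\<Prod>q\<in>primes_upto Q. q ^ k)"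
    proof (cases "j = 0")
      case False
      then have "q dvd q ^ j" by (simp add: dvd_power)
      then have "q dvd h" using q(2) by (rule dvd_trans)
      with assms(2) q(1) have *: "q \<le> Q" "\<not> q ^ k dvd h" by auto
      have "j \<le> k" using * q(2) by (meson dvd_trans le_imp_power_dvd nat_le_linear)
      then have "q ^ j dvd q ^ k" by (rule le_imp_power_dvd)
      also have "\<dots> dvd (\<Prod>q\<in>primes_upto Q. q ^ k)"
        using * q by (intro dvd_prodI) (auto simp: primes_upto_def)
      finally show ?thesis .
    qed auto
  qed (use assms in auto)
  show "(\<Prod>q\<in>primes_upto Q. q ^ k) > 0"
    by (intro prod_pos) (auto simp: primes_upto_def prime_gt_0_nat)
qed

text \<open>Cauchy's criterion makes one \<open>Q\<close> work for all \<open>y\<close>, so the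
  bound on the cofactor can be fixed before \<open>y\<close> grows.\<close>

lemma sum_ln_fib_rank_tail_small:
  assumes "\<epsilon> > 0"
  obtains Q where "Q \<ge> m" "\<And>y. (\<Sum>q | prime q \<and> Q < q \<and> q \<le> y.
      ln (real (q * fib_rank q)) / real (q * fib_rank q)) < \<epsilon>"
proof -
  define f where "f = (\<lambda>q. if prime q \<and> q > 5
      then ln (real (q * fib_rank q)) / real (q * fib_rank q) else 0)"
  have "summable f" unfolding f_def by (rule summable_ln_fib_rank)
  then obtain N where N: "\<And>a b. a \<ge> N \<Longrightarrow> norm (sum f {a..<b}) < \<epsilon>"
    using assms unfolding summable_Cauchy by blast
  \<comment> \<open>Including 5 makes the condition \<open>q > 5\<close> in \<open>f\<close>
    automatic on the tail.\<close>
  define Q where "Q = Max {N, m, 5}"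
  have Q: "Q \<ge> N" "Q \<ge> m" "Q \<ge> 5" by (auto simp: Q_def)
  have "(\<Sum>q | prime q \<and> Q < q \<and> q \<le> y. ln (real (q * fib_rank q)) / real (q * fib_rank q)) < \<epsilon>"
    for y
  proof -
    have "(\<Sum>q | prime q \<and> Q < q \<and> q \<le> y. ln (real (q * fib_rank q)) / real (q * fib_rank q))
        = sum f {Suc Q..<Suc y}"
      using Q by (intro sum.mono_neutral_cong_left) (auto simp: f_def)
    also have "\<dots> \<le> norm (sum f {Suc Q..<Suc y})" by simp
    also have "\<dots> < \<epsilon>" using Q by (intro N) auto
    finally show ?thesis .
  qed
  with Q that show ?thesis by blast
qed

text \<open>For fixed \<open>Q\<close> the sum is finite, and each term
  \<open>k * ln q / q ^ k\<close> tends to 0.\<close>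

lemma sum_ln_prime_powers_small:
  assumes "\<epsilon> > 0"
  obtains k where "k \<ge> m" "(\<Sum>q\<in>primes_upto Q. ln (real (q ^ k)) / real (q ^ k)) < \<epsilon>"
proof -
  have "(\<lambda>k. ln (real (q ^ k)) / real (q ^ k)) \<longlonglongrightarrow> 0" if "q \<in> primes_upto Q" for q
  proof -
    have q: "q > 1" using that by (auto simp: primes_upto_def prime_gt_Suc_0_nat)
    then have "(\<lambda>k. ln (real q) * (of_nat k * (1 / real q) ^ k)) \<longlonglongrightarrow> ln (real q) * 0"
      by (intro tendsto_mult tendsto_const powser_times_n_limit_0) auto
    moreover have "ln (real (q ^ k)) / real (q ^ k) = ln (real q) * (of_nat k * (1 / real q) ^ k)" for k
      using q by (simp add: ln_realpow power_divide)
    ultimately show ?thesis by simp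
  qed
  then have "(\<lambda>k. \<Sum>q\<in>primes_upto Q. ln (real (q ^ k)) / real (q ^ k))
      \<longlonglongrightarrow> (\<Sum>q\<in>primes_upto Q. 0)" by (rule tendsto_sum)
  then have "\<forall>\<^sub>F k in sequentially. (\<Sum>q\<in>primes_upto Q. ln (real (q ^ k)) / real (q ^ k)) < \<epsilon>"
    using assms by (intro order_tendstoD) auto
  then have "\<forall>\<^sub>F k in sequentially. k \<ge> m \<and>
      (\<Sum>q\<in>primes_upto Q. ln (real (q ^ k)) / real (q ^ k)) < \<epsilon>"
    using eventually_ge_at_top[of m] by eventually_elim auto
  then obtain k where "k \<ge> m" "(\<Sum>q\<in>primes_upto Q. ln (real (q ^ k)) / real (q ^ k)) < \<epsilon>"
    by (auto simp: eventually_sequentially)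
  then show ?thesis by (rule that)
qed

text \<open>A cofactor fails the smoothness condition defining \<open>C\<close> only through a prime
  \<open>q > Q\<close> or a power \<open>q ^ k\<close> with \<open>q \<le> Q\<close>. Each kind
  excludes at most \<open>Y / 128\<close> of the at least \<open>Y / 32\<close> primes, leaving
  \<open>Y / 64\<close>.\<close>

lemma many_primes_with_bounded_cofactor:
  obtains C :: nat where "C > 0"
    "\<forall>\<^sub>F y in sequentially. real y / (64 * ln (real y))
       \<le> real (card {p. p \<le> y \<and> p > 0 \<and> (\<exists>h\<in>{1..C}. p * h \<in> gcdFibSet)})"
proof -
  \<comment> \<open>Here \<open>3072 = 24 * 128\<close>, with 24 from the progression bound. Both
    \<open>Q \<ge> 128\<close> and, below, \<open>k \<ge> 7\<close> keep all moduli at least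
    128.\<close>
  obtain Q where Q: "Q \<ge> 128" "\<And>y. (\<Sum>q | prime q \<and> Q < q \<and> q \<le> y.
      ln (real (q * fib_rank q)) / real (q * fib_rank q)) < 1 / 3072"
    by (rule sum_ln_fib_rank_tail_small[of "1 / 3072" 128]) auto
  obtain k where k: "k \<ge> 7" "(\<Sum>q\<in>primes_upto Q. ln (real (q ^ k)) / real (q ^ k)) < 1 / 3072"
    by (rule sum_ln_prime_powers_small[of "1 / 3072" 7 Q]) auto
  define C where "C = (\<Prod>q\<in>primes_upto Q. q ^ k)"
  have "C > 0" unfolding C_def by (intro prod_pos) (auto simp: primes_upto_def prime_gt_0_nat)
  have "\<forall>\<^sub>F y::nat in sequentially. y \<ge> 4096" by (rule eventually_ge_at_top)
  with eventually_many_primes_near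
  have "\<forall>\<^sub>F y in sequentially. real y / (64 * ln (real y))
       \<le> real (card {p. p \<le> y \<and> p > 0 \<and> (\<exists>h\<in>{1..C}. p * h \<in> gcdFibSet)})"
  proof eventually_elim
    case (elim y)
    define P where "P = {p. prime p \<and> y div 64 < p \<and> p \<le> y}"
    define B where "B = (\<lambda>d. {p. prime p \<and> y div 64 < p \<and> p \<le> y \<and> (d dvd p - 1 \<or> d dvd p + 1)})"
    \<comment> \<open>The bound is \<open>y + 1\<close> because \<open>q\<close> divides
      \<open>r\<close>, which may equal \<open>p + 1\<close>.\<close>
    define T where "T = {q. prime q \<and> Q < q \<and> q \<le> y + 1}"
    define G where "G = {p. p \<le> y \<and> p > 0 \<and> (\<exists>h\<in>{1..C}. p * h \<in> gcdFibSet)}"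
    define Y where "Y = real y / ln (real y)"
    have finT: "finite T" by (rule finite_subset[of _ "{..y + 1}"]) (auto simp: T_def)
    have finG: "finite G" by (rule finite_subset[of _ "{..y}"]) (auto simp: G_def)
    have finB: "finite (B d)" for d by (rule finite_subset[of _ "{..y}"]) (auto simp: B_def)
    have Y: "Y \<ge> 0" using elim by (simp add: Y_def)
    have B_le: "real (card (B d)) \<le> 24 * Y * (ln (real d) / real d)" if "d \<ge> 128" for d
      using card_primes_neighbour_multiple_le[OF that elim(2)] by (simp add: B_def Y_def)
    have UN_le: "real (card (\<Union>i\<in>I. B (g i))) \<le> Y / 128"
      if "finite I" "\<And>i. i \<in> I \<Longrightarrow> g i \<ge> 128"
        "(\<Sum>i\<in>I. ln (real (g i)) / real (g i)) < 1 / 3072" for I :: "nat set" and g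
    proof -
      have "card (\<Union>i\<in>I. B (g i)) \<le> (\<Sum>i\<in>I. card (B (g i)))"
        using that(1) by (rule card_UN_le)
      then have "real (card (\<Union>i\<in>I. B (g i))) \<le> real (\<Sum>i\<in>I. card (B (g i)))"
        by (simp only: of_nat_le_iff)
      also have "\<dots> \<le> (\<Sum>i\<in>I. 24 * Y * (ln (real (g i)) / real (g i)))"
        unfolding of_nat_sum using that(2) by (intro sum_mono B_le) auto
      also have "\<dots> = 24 * Y * (\<Sum>i\<in>I. ln (real (g i)) / real (g i))"
        by (rule sum_distrib_left[symmetric])
      also have "\<dots> \<le> 24 * Y * (1 / 3072)" using that(3) Y by (intro mult_left_mono) auto
      finally show ?thesis by simp
    qed
    define B1 where "B1 = (\<Union>q\<in>T. B (q * fib_rank q))"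
    define B2 where "B2 = (\<Union>q\<in>primes_upto Q. B (q ^ k))"
    have bad1: "real (card B1) \<le> Y / 128"
      unfolding B1_def
    proof (rule UN_le[OF finT, of "\<lambda>q. q * fib_rank q"])
      fix q assume "q \<in> T"
      then have q: "prime q" "q > Q" by (auto simp: T_def)
      then have "fib_rank q \<ge> 1" using Q(1) fib_rank_prime_bounds(1)[of q] by simp
      then have "q * 1 \<le> q * fib_rank q" by (intro mult_le_mono) simp_all
      with q(2) Q(1) show "q * fib_rank q \<ge> 128" by linarith
    next
      show "(\<Sum>q\<in>T. ln (real (q * fib_rank q)) / real (q * fib_rank q)) < 1 / 3072"
        unfolding T_def by (rule Q(2))
    qed
    have bad2: "real (card B2) \<le> Y / 128"
      unfolding B2_def
    proof (rule UN_le)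
      fix q assume "q \<in> primes_upto Q"
      then have "q \<ge> 2" by (auto simp: primes_upto_def prime_ge_2_nat)
      then have "2 ^ k \<le> q ^ k" by (intro power_mono) auto
      moreover have "(2::nat) ^ 7 \<le> 2 ^ k" using k by (intro power_increasing) auto
      ultimately show "q ^ k \<ge> 128" by simp
    qed (use k in auto)
    have "P \<subseteq> G \<union> (B1 \<union> B2)"
    proof
      fix p assume "p \<in> P"
      then have p: "prime p" "y div 64 < p" "p \<le> y" by (auto simp: P_def)
      then have "p > 5" using elim by auto
      then obtain r where r: "r \<in> {p - 1, p + 1}" "p dvd fib r"
        using prime_dvd_fib_neighbour[OF p(1)] by auto
      obtain h where h: "gcd (p * r) (fib (p * r)) = p * h" "h > 0" "h dvd r"
        "\<And>q. prime q \<Longrightarrow> q > 5 \<Longrightarrow> q dvd h \<Longrightarrow> q * fib_rank q dvd r"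
        using gcd_fib_cofactor[OF p(1) \<open>p > 5\<close> r] by blast
      have r0: "0 < r" "r \<le> y + 1" using r p \<open>p > 5\<close> by auto
      have inB: "p \<in> B d" if "d dvd r" for d using that r p by (auto simp: B_def)
      show "p \<in> G \<union> (B1 \<union> B2)"
      proof (cases "\<forall>q. prime q \<and> q dvd h \<longrightarrow> q \<le> Q \<and> \<not> q ^ k dvd h")
        case True
        then have "h \<le> C" unfolding C_def using h(2) by (intro smooth_le_prod_prime_powers) auto
        moreover have "p * h \<in> gcdFibSet"
          unfolding gcdFibSet_def h(1)[symmetric] using r0 p(2) by force
        ultimately show ?thesis using h(2) p by (auto simp: G_def)
      next
        case False
        then obtain q where q: "prime q" "q dvd h" "\<not> (q \<le> Q \<and> \<not> q ^ k dvd h)" by blast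
        show ?thesis
        proof (cases "q > Q")
          case True
          have "q dvd r" using q(2) h(3) by (rule dvd_trans)
          then have "q \<le> y + 1" using r0 by (meson dvd_imp_le le_trans)
          then have "q \<in> T" using True q by (simp add: T_def)
          moreover have "p \<in> B (q * fib_rank q)"
            using True Q(1) q by (intro inB h(4)) auto
          ultimately show ?thesis by (auto simp: B1_def)
        next
          case False
          with q have "q \<in> primes_upto Q" "q ^ k dvd h" by (auto simp: primes_upto_def)
          moreover from this h(3) have "p \<in> B (q ^ k)" by (intro inB) (rule dvd_trans)
          ultimately show ?thesis by (auto simp: B2_def)
        qed
      qed
    qed
    then have "card P \<le> card (G \<union> (B1 \<union> B2))"
      using finG finT finB by (intro card_mono) (auto simp: B1_def B2_def)
    also have "\<dots> \<le> card G + card (B1 \<union> B2)"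
      by (rule card_Un_le)
    also have "\<dots> \<le> card G + (card B1 + card B2)"
      by (intro add_left_mono card_Un_le)
    finally have "real (card P) \<le> real (card G) + (Y / 128 + Y / 128)"
      using bad1 bad2 by linarith
    moreover have "Y / 32 \<le> real (card P)" using elim(1) by (simp add: P_def Y_def mult.commute)
    ultimately have "Y / 64 \<le> real (card G)" by linarith
    then show ?case by (simp add: G_def Y_def mult.commute)
  qed
  with \<open>C > 0\<close> show ?thesis by (rule that)
qed

section \<open>From primes to elements of the set, and from integers to real
  \<open>x\<close>\<close>

text \<open>With a cofactor \<open>h p\<close> chosen for each \<open>p\<close>, the pair
  \<open>(h p, p * h p)\<close> determines \<open>p\<close>, so each element arises from at most
  \<open>C\<close> values of \<open>p\<close>.\<close>

lemma eventually_card_gcdFibSet_ge: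
  obtains C :: nat where "C > 0"
    "\<forall>\<^sub>F y in sequentially. real y / (64 * ln (real y))
       \<le> real C * real (card {a \<in> gcdFibSet. a \<le> C * y})"
proof -
  obtain C :: nat where C: "C > 0"
    "\<forall>\<^sub>F y in sequentially. real y / (64 * ln (real y))
       \<le> real (card {p. p \<le> y \<and> p > 0 \<and> (\<exists>h\<in>{1..C}. p * h \<in> gcdFibSet)})"
    by (rule many_primes_with_bounded_cofactor)
  have "card {p. p \<le> y \<and> p > 0 \<and> (\<exists>h\<in>{1..C}. p * h \<in> gcdFibSet)}
      \<le> C * card {a \<in> gcdFibSet. a \<le> C * y}" for y
  proof -
    define G where "G = {p. p \<le> y \<and> p > 0 \<and> (\<exists>h\<in>{1..C}. p * h \<in> gcdFibSet)}"
    define A where "A = {a \<in> gcdFibSet. a \<le> C * y}"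
    have finA: "finite A" by (rule finite_subset[of _ "{..C * y}"]) (auto simp: A_def)
    have "\<forall>p\<in>G. \<exists>h\<in>{1..C}. p * h \<in> gcdFibSet" by (auto simp: G_def)
    then obtain h where h: "\<And>p. p \<in> G \<Longrightarrow> h p \<in> {1..C} \<and> p * h p \<in> gcdFibSet" by metis
    have "inj_on (\<lambda>p. (h p, p * h p)) G"
    proof (rule inj_onI)
      fix p p' assume "p \<in> G" "p' \<in> G" "(h p, p * h p) = (h p', p' * h p')"
      with h[of p] show "p = p'" by auto
    qed
    moreover have "(\<lambda>p. (h p, p * h p)) ` G \<subseteq> {1..C} \<times> A"
    proof (rule image_subsetI)
      fix p assume p: "p \<in> G"
      then have "p \<le> y" by (simp add: G_def)
      with h[OF p] have "p * h p \<le> y * C" by (intro mult_le_mono) auto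
      with h[OF p] show "(h p, p * h p) \<in> {1..C} \<times> A" by (auto simp: A_def mult.commute)
    qed
    ultimately have "card G \<le> card ({1..C} \<times> A)"
      using finA by (intro card_inj_on_le) auto
    then show ?thesis by (simp add: G_def A_def card_cartesian_product)
  qed
  then have le: "real (card {p. p \<le> y \<and> p > 0 \<and> (\<exists>h\<in>{1..C}. p * h \<in> gcdFibSet)})
      \<le> real C * real (card {a \<in> gcdFibSet. a \<le> C * y})" for y
    unfolding of_nat_mult[symmetric] of_nat_le_iff .
  have "\<forall>\<^sub>F y in sequentially. real y / (64 * ln (real y))
       \<le> real C * real (card {a \<in> gcdFibSet. a \<le> C * y})"
    using C(2) by (rule eventually_mono) (rule order_trans[OF _ le])
  with C(1) show ?thesis by (rule that)
qed

theorem theorem1p1: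
  shows "\<exists>c::real. c > 0 \<and>
    (\<forall>x::real. x \<ge> 2 \<longrightarrow>
       real (card {a \<in> gcdFibSet. real a \<le> x}) \<ge> c * x / ln x)"
proof -
  obtain C :: nat where C: "C > 0"
    "\<forall>\<^sub>F y in sequentially. real y / (64 * ln (real y))
       \<le> real C * real (card {a \<in> gcdFibSet. a \<le> C * y})"
    by (rule eventually_card_gcdFibSet_ge)
  then obtain y0 where y0: "\<And>y. y \<ge> y0 \<Longrightarrow> real y / (64 * ln (real y))
       \<le> real C * real (card {a \<in> gcdFibSet. a \<le> C * y})"
    by (auto simp: eventually_sequentially)
  \<comment> \<open>The summand 2 ensures \<open>ln y > 0\<close> for \<open>y\<close> the floor of
    \<open>x / C\<close>.\<close>
  define M where "M = real C * real (y0 + 2)"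
  have M: "M > 0" using C by (simp add: M_def)
  \<comment> \<open>For \<open>x < M\<close> the second bound gives
    \<open>c * x \<le> ln 2 \<le> ln x\<close>, and the element 1 suffices. For
    \<open>x \<ge> M\<close> the factor 128 is 64 times the 2 lost in rounding; one \<open>C\<close>
    comes from rescaling, the other from multiplicity.\<close>
  define c where "c = min (1 / (128 * real C ^ 2)) (ln 2 / M)"
  have c: "c > 0" "c \<le> 1 / (128 * real C ^ 2)" "c \<le> ln 2 / M" using C M by (auto simp: c_def)
  have fin: "finite {a \<in> gcdFibSet. real a \<le> x}" for x
    by (rule finite_subset[of _ "{..nat \<lfloor>x\<rfloor>}"]) (auto simp: le_nat_floor)
  have "c * x / ln x \<le> real (card {a \<in> gcdFibSet. real a \<le> x})" if x: "x \<ge> 2" for x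
  proof (cases "x < M")
    case True
    have "1 \<in> gcdFibSet" unfolding gcdFibSet_def by (auto intro!: exI[of _ 1])
    then have card_pos: "card {a \<in> gcdFibSet. real a \<le> x} > 0"
      using x fin by (subst card_gt_0_iff) auto
    have "c * x \<le> (ln 2 / M) * M" using c x True M by (intro mult_mono) auto
    then have "c * x \<le> ln 2" using M by simp
    moreover have "ln 2 \<le> ln x" using x by simp
    ultimately have "c * x \<le> ln x" by linarith
    then have "c * x / ln x \<le> 1" using x by (simp add: divide_le_eq)
    then show ?thesis using card_pos by linarith
  next
    case False
    define y where "y = nat \<lfloor>x / real C\<rfloor>"
    have xC: "x / real C \<ge> real (y0 + 2)" using False C by (simp add: M_def field_simps)
    then have y: "y \<ge> y0 + 2" unfolding y_def by (rule le_nat_floor)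
    have yx: "real y \<le> x / real C" unfolding y_def using xC by (intro of_nat_floor) auto
    have "x / real C < real y + 1" unfolding y_def using xC by linarith
    \<comment> \<open>Rounding down loses at most half, since
      \<open>y + 1 \<le> 2 * y\<close>.\<close>
    then have y_ge: "x / (2 * real C) \<le> real y" using y by (simp add: field_simps)
    have C1: "real C \<ge> 1" using C by simp
    have "x / real C \<le> x / 1" using x C1 by (intro divide_left_mono) auto
    then have ln_le: "ln (real y) \<le> ln x" using yx y x by (subst ln_le_cancel_iff) auto
    have ln_pos: "ln (real y) > 0" using y by simp
    have "c * x / ln x \<le> (1 / (128 * real C ^ 2)) * x / ln x"
      using c x by (intro divide_right_mono mult_right_mono) auto
    also have "\<dots> = (x / (2 * real C)) / (64 * ln x) / real C"
      by (simp add: power2_eq_square)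
    also have "\<dots> \<le> real y / (64 * ln (real y)) / real C"
      using y_ge ln_le ln_pos x C1 by (intro divide_right_mono frac_le) auto
    also have "\<dots> \<le> real (card {a \<in> gcdFibSet. a \<le> C * y})"
      using y0[of y] y C1 by (simp add: divide_le_eq mult_ac)
    also have "card {a \<in> gcdFibSet. a \<le> C * y} \<le> card {a \<in> gcdFibSet. real a \<le> x}"
    proof (intro card_mono fin subsetI)
      fix a assume "a \<in> {a \<in> gcdFibSet. a \<le> C * y}"
      then have "a \<in> gcdFibSet" "real a \<le> real (C * y)" by (auto simp del: of_nat_mult)
      moreover have "real (C * y) \<le> x" using yx C1 by (simp add: field_simps)
      ultimately show "a \<in> {a \<in> gcdFibSet. real a \<le> x}" by auto
    qed
    finally show ?thesis by simp
  qed
  with c(1) show ?thesis by blast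
qed

end
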